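(* Let $L$ be a complete multiplicative lattice. Then $\mathrm{Spec}(L)$, equipped with the Zariski topology, is a sober space. That is: (a) $\mathrm{Spec}(L)$ is a $\mathrm{T}_0$-space; (b) every irreducible closed subset of $\mathrm{Spec}(L)$ is the closure of a one-element set.
   Context: A complete multiplicative lattice is a complete lattice $L$ (smallest element $0$, largest element $1$) equipped with a binary multiplication satisfying $xy\leqslant x\wedge y$ for all $x,y\in L$; no associativity, commutativity, monotonicity or unit is assumed. An element $p\neq 1$ of $L$ is prime if for all $x,y\in L$, $xy\leqslant p$ implies $x\leqslant p$ or $y\leqslant p$. $\mathrm{Spec}(L)$ is the set of all prime elements of $L$, with the Zariski topology, whose closed sets are exactly the sets $\mathrm{V}(x)=\{p\in\mathrm{Spec}(L)\mid x\leqslant p\}$, $x\in L$. (Irreducible closed sets are non-empty by convention.) *)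

theory Defs
  imports "HOL-Analysis.Analysis"
begin

class complete_multiplicative_lattice = complete_lattice + times +
  assumes mult_le_inf: "x * y \<le> inf x y"

definition prime_element :: "'a::complete_multiplicative_lattice \<Rightarrow> bool" where
  "prime_element p \<longleftrightarrow> p \<noteq> top \<and> (\<forall>x y. x * y \<le> p \<longrightarrow> x \<le> p \<or> y \<le> p)"

definition Spec :: "'a::complete_multiplicative_lattice set" where
  "Spec = {p. prime_element p}"

definition V :: "'a::complete_multiplicative_lattice \<Rightarrow> 'a set" where
  "V x = {p \<in> Spec. x \<le> p}"

definition zariski_topology :: "'a::complete_multiplicative_lattice topology" where
  "zariski_topology = topology (\<lambda>U. \<exists>x. U = Spec - V x)"

definition irreducible_in :: "'b topology \<Rightarrow> 'b set \<Rightarrow> bool" where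
  "irreducible_in X S \<longleftrightarrow> S \<subseteq> topspace X \<and> S \<noteq> {} \<and>
     (\<forall>A B. closedin (subtopology X S) A \<and> closedin (subtopology X S) B \<and> S = A \<union> B
        \<longrightarrow> A = S \<or> B = S)"

definition sober_space :: "'b topology \<Rightarrow> bool" where
  "sober_space X \<longleftrightarrow> t0_space X \<and>
     (\<forall>C. closedin X C \<and> irreducible_in X C \<longrightarrow> (\<exists>p \<in> topspace X. C = X closure_of {p}))"

(* The operator topology is only meaningful on families that satisfy istopology; the following
   facts show that this is the case here, and that the closed sets are exactly the sets V x. *)

lemma V_bot: "V bot = Spec"
  by (auto simp: V_def)

lemma V_top: "V top = {}"
  by (auto simp: V_def Spec_def prime_element_def top_unique)

lemma V_mult: "V (x * y) = V x \<union> V y"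
proof -
  have "x * y \<le> x" "x * y \<le> y"
    using mult_le_inf[of x y] by auto
  then show ?thesis
    by (auto simp: V_def Spec_def prime_element_def intro: order_trans)
qed

lemma V_Sup: "V (Sup A) = {p \<in> Spec. \<forall>x\<in>A. p \<in> V x}"
  by (auto simp: V_def Sup_le_iff)

lemma istopology_zariski:
  "istopology (\<lambda>U. \<exists>x::'a::complete_multiplicative_lattice. U = Spec - V x)"
  unfolding istopology_def
proof (intro conjI allI impI)
  fix S T :: "'a set"
  assume "\<exists>x. S = Spec - V x" "\<exists>x. T = Spec - V x"
  then obtain x y where "S = Spec - V x" "T = Spec - V y"
    by blast
  then have "S \<inter> T = Spec - V (x * y)"
    by (auto simp: V_mult)
  then show "\<exists>x. S \<inter> T = Spec - V x" ..
next
  fix K :: "'a set set"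
  assume "\<forall>U\<in>K. \<exists>x. U = Spec - V x"
  then obtain f where f: "\<And>U. U \<in> K \<Longrightarrow> U = Spec - V (f U)"
    by metis
  have "\<Union>K = (\<Union>U\<in>K. Spec - V (f U))"
    using f by blast
  also have "\<dots> = Spec - V (Sup (f ` K))"
    by (auto simp: V_Sup)
  finally show "\<exists>x. \<Union>K = Spec - V x" ..
qed

lemma openin_zariski: "openin zariski_topology U \<longleftrightarrow> (\<exists>x. U = Spec - V x)"
  by (simp add: zariski_topology_def topology_inverse'[OF istopology_zariski])

lemma topspace_zariski: "topspace zariski_topology = Spec"
proof
  show "topspace zariski_topology \<subseteq> Spec"
    using openin_topspace[of zariski_topology] unfolding openin_zariski by blast
  have "openin zariski_topology (Spec - V top)"
    by (auto simp: openin_zariski)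
  then show "Spec \<subseteq> topspace zariski_topology"
    by (auto simp: V_top dest: openin_subset)
qed

lemma closedin_zariski: "closedin zariski_topology C \<longleftrightarrow> (\<exists>x. C = V x)"
proof -
  have "C \<subseteq> Spec \<and> Spec - C = Spec - V x \<longleftrightarrow> C = V x" for x
    by (auto simp: V_def)
  then show ?thesis
    unfolding closedin_def topspace_zariski openin_zariski by blast
qed

end

(* The closure of a point p is V p, so the order can be read off from the topology, which gives T0.
   The generic point of an irreducible closed set C is Inf C: if x * y \<le> Inf C, then
   C \<subseteq> V (x * y) = V x \<union> V y, so irreducibility puts C inside V x or V y. *)
theory Submission
  imports Defs
begin

text \<open>A closed set \<open>V x\<close> containing \<open>p\<close> has
  \<open>x \<le> p\<close>, so by transitivity it contains everything above
  \<open>p\<close>.\<close>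

lemma closure_of_zariski:
  assumes "p \<in> Spec"
  shows "zariski_topology closure_of {p} = V p"
proof (rule closure_of_unique)
  show "{p} \<subseteq> V p"
    using assms by (simp add: V_def)
  show "closedin zariski_topology (V p)"
    by (auto simp: closedin_zariski)
  show "V p \<subseteq> T" if "{p} \<subseteq> T" "closedin zariski_topology T" for T
    using that by (auto simp: closedin_zariski V_def intro: order_trans)
qed

lemma t0_space_zariski:
  "t0_space (zariski_topology :: 'a::complete_multiplicative_lattice topology)"
  unfolding t0_space_def topspace_zariski
proof (intro ballI impI)
  fix p q :: 'a
  assume pq: "p \<in> Spec" "q \<in> Spec" "p \<noteq> q"
  \<comment> \<open>By antisymmetry \<open>p \<le> q\<close> and \<open>q \<le> p\<close> cannot
    both hold; the complement of \<open>V p\<close> or of \<open>V q\<close> then separates the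
    points.\<close>
  then have "p \<in> V p" "q \<in> V q" "q \<notin> V p \<or> p \<notin> V q"
    by (auto simp: V_def)
  with pq show "\<exists>U. openin zariski_topology U \<and> (p \<notin> U \<longleftrightarrow> q \<in> U)"
    by (metis Diff_iff openin_zariski)
qed

text \<open>Intersecting with \<open>C\<close> turns a cover by two closed sets into a decomposition
  into relatively closed sets, the form used in \<open>irreducible_in\<close>.\<close>

lemma irreducible_zariski_subset:
  assumes irr: "irreducible_in zariski_topology C" and sub: "C \<subseteq> V x \<union> V y"
  shows "C \<subseteq> V x \<or> C \<subseteq> V y"
proof -
  have "closedin (subtopology zariski_topology C) (C \<inter> V z)" for z
    by (auto simp: closedin_subtopology closedin_zariski)
  moreover have "C = (C \<inter> V x) \<union> (C \<inter> V y)"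
    using sub by blast
  ultimately have "C \<inter> V x = C \<or> C \<inter> V y = C"
    using irr unfolding irreducible_in_def by blast
  then show ?thesis
    by blast
qed

lemma Inf_irreducible_in_Spec:
  assumes irr: "irreducible_in zariski_topology C"
  shows "Inf C \<in> Spec"
proof -
  have C: "C \<subseteq> Spec" "C \<noteq> {}"
    using irr by (auto simp: irreducible_in_def topspace_zariski)
  then have sub_V: "C \<subseteq> V x \<longleftrightarrow> x \<le> Inf C" for x
    by (auto simp: V_def le_Inf_iff)
  \<comment> \<open>Non-emptiness of \<open>C\<close> matters here, since
    \<open>Inf {} = top\<close>.\<close>
  obtain q where "q \<in> C" "q \<noteq> top"
    using C by (auto simp: Spec_def prime_element_def)
  then have "Inf C \<noteq> top"
    by (metis Inf_lower top_unique)
  moreover have "x \<le> Inf C \<or> y \<le> Inf C" if "x * y \<le> Inf C" for x y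
    using irreducible_zariski_subset[OF irr, of x y] that by (simp add: V_mult flip: sub_V)
  ultimately show ?thesis
    by (simp add: Spec_def prime_element_def)
qed

theorem lemma2p6:
  shows "sober_space (zariski_topology :: 'a::complete_multiplicative_lattice topology)"
  unfolding sober_space_def
proof (intro conjI allI impI t0_space_zariski)
  fix C :: "'a set"
  assume C: "closedin zariski_topology C \<and> irreducible_in zariski_topology C"
  then obtain z where z: "C = V z"
    by (auto simp: closedin_zariski)
  have p: "Inf C \<in> Spec"
    using C Inf_irreducible_in_Spec by blast
  \<comment> \<open>As \<open>z\<close> is a lower bound of \<open>V z\<close>, everything above
    \<open>Inf C\<close> is above \<open>z\<close>; conversely, members of \<open>C\<close> lie
    above \<open>Inf C\<close>.\<close>
  have "z \<le> Inf C"
    by (auto simp: z V_def le_Inf_iff)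
  then have "C = V (Inf C)"
    by (auto simp: z V_def intro: Inf_lower order_trans)
  with p show "\<exists>p \<in> topspace zariski_topology. C = zariski_topology closure_of {p}"
    by (auto simp: topspace_zariski closure_of_zariski)
qed

end
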